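(* Let $n\ge2$. There exists $A\in\mathbb{C}^{n\times n}$ that cannot be expressed as a product of $r$ circulant matrices for any $r\in\mathbb{N}$.
   Context: All factors are $n\times n$ with complex entries. A matrix $X$ is circulant if there are $x_0,\dots,x_{n-1}\in\mathbb{C}$ such that the $(i,j)$ entry of $X$ is $x_{(i-j)\bmod n}$ for all $1\le i,j\le n$. *)

theory Defs
  imports Complex_Main "Jordan_Normal_Form.Matrix"
begin

(* Matrix indices run over 0..n-1 rather than 1..n; the shift leaves the difference i - j unchanged.
   The difference is taken in int because subtraction on nat truncates; its residue lies in 0..n-1,
   so only the values x 0, ..., x (n-1) matter. *)
definition circulant_mat :: "nat \<Rightarrow> complex mat \<Rightarrow> bool" where
  "circulant_mat n X \<longleftrightarrow> X \<in> carrier_mat n n \<and>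
     (\<exists>x :: nat \<Rightarrow> complex. \<forall>i<n. \<forall>j<n. X $$ (i, j) = x (nat ((int i - int j) mod int n)))"

(* The type of matrices of all dimensions has no unit, so prod_list is not available; the empty
   product is the n x n identity. *)
definition mat_prod_list :: "nat \<Rightarrow> complex mat list \<Rightarrow> complex mat" where
  "mat_prod_list n Xs = foldr (*) Xs (1\<^sub>m n)"

end

theory Submission
  imports Defs
begin

text \<open>
  Every row of a circulant matrix is a rearrangement of the same \<open>n\<close> numbers, so all its rows have
  the same sum; equivalently, the all-ones vector is an eigenvector. A common eigenvector of the
  factors is an eigenvector of their product, so every product of circulant matrices has constant
  row sums, whatever the number of factors. The diagonal matrix unit with entry \<open>1\<close> in the top left
  corner has row sums \<open>1, 0, \<dots>, 0\<close>, which differ as soon as \<open>n \<ge> 2\<close>.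
\<close>

definition constant_row_sums :: "nat \<Rightarrow> 'a :: semiring_0 mat \<Rightarrow> bool" where
  "constant_row_sums n X \<longleftrightarrow> X \<in> carrier_mat n n \<and> (\<exists>c. \<forall>i<n. (\<Sum>j<n. X $$ (i, j)) = c)"

lemma constant_row_sums_one: "constant_row_sums n (1\<^sub>m n :: 'a :: semiring_1 mat)"
  by (auto simp: constant_row_sums_def intro!: exI[of _ 1])

text \<open>The row sum of the product is the product of the row sums, as for eigenvalues.\<close>

lemma constant_row_sums_mult:
  assumes "constant_row_sums n X" and "constant_row_sums n Y"
  shows "constant_row_sums n (X * Y)"
proof -
  obtain c d where X: "X \<in> carrier_mat n n" "\<And>i. i < n \<Longrightarrow> (\<Sum>j<n. X $$ (i, j)) = c"
    and Y: "Y \<in> carrier_mat n n" "\<And>i. i < n \<Longrightarrow> (\<Sum>j<n. Y $$ (i, j)) = d"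
    using assms by (auto simp: constant_row_sums_def)
  have "(\<Sum>j<n. (X * Y) $$ (i, j)) = c * d" if "i < n" for i
  proof -
    have "(\<Sum>j<n. (X * Y) $$ (i, j)) = (\<Sum>j<n. \<Sum>k<n. X $$ (i, k) * Y $$ (k, j))"
      using that X(1) Y(1) by (intro sum.cong) (auto simp: scalar_prod_def lessThan_atLeast0)
    also have "\<dots> = (\<Sum>k<n. X $$ (i, k) * (\<Sum>j<n. Y $$ (k, j)))"
      by (subst sum.swap) (simp add: sum_distrib_left)
    also have "\<dots> = (\<Sum>k<n. X $$ (i, k)) * d"
      by (simp add: Y(2) sum_distrib_right)
    finally show ?thesis
      by (simp add: X(2)[OF that])
  qed
  with X(1) Y(1) show ?thesis
    by (auto simp: constant_row_sums_def)
qed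

text \<open>For fixed \<open>i\<close>, the map \<open>j \<mapsto> (i - j) mod n\<close> is an involution of the residues, so each row runs
  once through the values \<open>x 0, \<dots>, x (n - 1)\<close>.\<close>

lemma circulant_imp_constant_row_sums:
  assumes "circulant_mat n X"
  shows "constant_row_sums n X"
proof -
  obtain x where X: "X \<in> carrier_mat n n"
    and x: "\<And>i j. i < n \<Longrightarrow> j < n \<Longrightarrow> X $$ (i, j) = x (nat ((int i - int j) mod int n))"
    using assms by (auto simp: circulant_mat_def)
  have "(\<Sum>j<n. X $$ (i, j)) = (\<Sum>k<n. x k)" if "i < n" for i
  proof (rule sum.reindex_bij_witness)
    let ?f = "\<lambda>j. nat ((int i - int j) mod int n)"
    have inv: "?f (?f j) = j" and mem: "?f j \<in> {..<n}" if "j < n" for j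
      using that by (simp_all add: mod_simps nat_less_iff)
    fix j assume "j \<in> {..<n}"
    then show "?f (?f j) = j" "?f (?f j) = j" "?f j \<in> {..<n}" "?f j \<in> {..<n}"
      "x (?f j) = X $$ (i, j)"
      using inv mem x \<open>i < n\<close> by auto
  qed
  with X show ?thesis
    by (auto simp: constant_row_sums_def)
qed

lemma constant_row_sums_mat_prod_list:
  assumes "\<And>X. X \<in> set Xs \<Longrightarrow> constant_row_sums n X"
  shows "constant_row_sums n (mat_prod_list n Xs)"
  using assms
  by (induction Xs)
     (auto simp: mat_prod_list_def intro: constant_row_sums_one constant_row_sums_mult)

theorem proposition6p4:
  fixes n :: nat
  assumes "n \<ge> 2"
  shows "\<exists>A \<in> carrier_mat n n. \<forall>r :: nat. \<not> (\<exists>Xs :: complex mat list.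
           length Xs = r \<and> (\<forall>X \<in> set Xs. circulant_mat n X) \<and> A = mat_prod_list n Xs)"
proof -
  define A :: "complex mat" where
    "A = mat n n (\<lambda>(i, j). if j = 0 then if i = 0 then 1 else 0 else 0)"
  have row_sum: "(\<Sum>j<n. A $$ (i, j)) = (if i = 0 then 1 else 0)" if "i < n" for i
    using that assms by (simp add: A_def)
  have "\<not> constant_row_sums n A"
  proof
    assume "constant_row_sums n A"
    then have "(\<Sum>j<n. A $$ (0, j)) = (\<Sum>j<n. A $$ (1, j))"
      using assms by (auto simp: constant_row_sums_def)
    then show False
      using row_sum[of 0] row_sum[of 1] assms by simp
  qed
  moreover have "A \<in> carrier_mat n n"
    by (simp add: A_def)
  ultimately show ?thesis
    using constant_row_sums_mat_prod_list circulant_imp_constant_row_sums by metis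
qed

end
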